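(* Let $Y$ be a real random variable whose moment generating function $E[e^{tY}]$ exists for $|t|<r$, for some $r>0$. Then for any integers $n,k$ with $n\ge k\ge 0$ and every real $x$, $$\sum_{j=0}^{n-k}\binom{n}{k}k^{j}x^{j}L_{Y}(n-k,j)= B_{n,k}\Big(B_{0}^{(L,Y)}(x),\,2B_{1}^{(L,Y)}(x),\,\dots,\,(n-k+1)B_{n-k}^{(L,Y)}(x)\Big),$$ with the convention $0^0=1$.
   Context: Partial Bell polynomials $B_{n,k}$ ($n\ge k\ge 0$) are defined by the formal power series identity $$\frac{1}{k!}\left(\sum_{j=1}^{\infty}x_{j}\frac{t^{j}}{j!}\right)^{k}=\sum_{n=k}^{\infty}B_{n,k}(x_{1},x_{2},\dots,x_{n-k+1})\frac{t^{n}}{n!}.$$ On the right-hand side of the claim the $i$-th argument of $B_{n,k}$ is $iB_{i-1}^{(L,Y)}(x)$ (for $k=0$, $B_{n,0}$ is the constant $1$ if $n=0$ and $0$ if $n\geq 1$). The probabilistic Lah numbers $L_Y(n,k)$ ($n\ge k\ge 0$) associated with $Y$ are defined by the power series expansion about $t=0$ $$\frac{1}{k!}\left(E\left[\left(\frac{1}{1-t}\right)^{Y}\right]-1\right)^{k}=\sum_{n=k}^{\infty}L_{Y}(n,k)\frac{t^{n}}{n!},\quad k\ge 0.$$ The probabilistic Lah-Bell polynomials associated with $Y$ are $B_{n}^{(L,Y)}(x)=\sum_{k=0}^{n}L_{Y}(n,k)x^{k}$, $n\ge 0$. *)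

theory Defs
  imports "HOL-Probability.Probability"
begin

text \<open>
  The arguments \<open>x\<^sub>1, x\<^sub>2, \<dots>\<close> of the partial Bell polynomial are passed as a sequence \<open>x\<close>
  (the value \<open>x 0\<close> is ignored); by \<open>partial_Bell_cong\<close> below only \<open>x\<^sub>1, \<dots>, x\<^sub>n\<^sub>-\<^sub>k\<^sub>+\<^sub>1\<close> matter.
\<close>

definition partial_Bell :: "nat \<Rightarrow> nat \<Rightarrow> (nat \<Rightarrow> real) \<Rightarrow> real" where
  "partial_Bell n k x =
     fact n * fps_nth (fps_const (1 / fact k) *
                       Abs_fps (\<lambda>j. if j = 0 then 0 else x j / fact j) ^ k) n"

text \<open>
  The power series in \<open>t\<close> about \<open>0\<close> representing \<open>(E[(1/(1-t))\<^sup>Y] - 1)\<^sup>k / k!\<close>; it is unique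
  whenever it exists, see \<open>prob_Lah_eqI\<close>.
\<close>

definition prob_Lah :: "'a measure \<Rightarrow> ('a \<Rightarrow> real) \<Rightarrow> nat \<Rightarrow> nat \<Rightarrow> real" where
  "prob_Lah M Y n k =
     fact n * fps_nth (THE F. (\<lambda>t::real. 1 / fact k *
       ((LINT \<omega>|M. (1 / (1 - t)) powr Y \<omega>) - 1) ^ k) has_fps_expansion F) n"

definition prob_Lah_Bell :: "'a measure \<Rightarrow> ('a \<Rightarrow> real) \<Rightarrow> nat \<Rightarrow> real \<Rightarrow> real" where
  "prob_Lah_Bell M Y n x = (\<Sum>k=0..n. prob_Lah M Y n k * x ^ k)"

lemma partial_Bell_gf:
  "fps_const (1 / fact k) * Abs_fps (\<lambda>j. if j = 0 then 0 else x j / fact j) ^ k =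
     Abs_fps (\<lambda>n. partial_Bell n k x / fact n)"
  by (rule fps_ext) (simp add: partial_Bell_def)

lemma partial_Bell_eq_0:
  assumes "n < k"
  shows "partial_Bell n k x = 0"
proof -
  have "fps_nth (Abs_fps (\<lambda>j. if j = 0 then 0 else x j / fact j) ^ k) n = 0"
    by (rule startsby_zero_power_prefix[rule_format]) (use assms in auto)
  then show ?thesis by (simp add: partial_Bell_def)
qed

lemma partial_Bell_0: "partial_Bell n 0 x = (if n = 0 then 1 else 0)"
  by (simp add: partial_Bell_def)

lemma partial_Bell_cong:
  assumes "\<And>i. i \<in> {1..n - k + 1} \<Longrightarrow> x i = y i"
  shows "partial_Bell n k x = partial_Bell n k y"
proof -
  define S where "S x = Abs_fps (\<lambda>j. x (Suc j) / fact (Suc j) :: real)" for x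
  have *: "Abs_fps (\<lambda>j. if j = 0 then 0 else x j / fact j) = fps_X * S x" for x
  proof (rule fps_ext)
    fix n
    show "fps_nth (Abs_fps (\<lambda>j. if j = 0 then 0 else x j / fact j)) n = fps_nth (fps_X * S x) n"
      by (cases n) (simp_all add: S_def)
  qed
  have pw: "fps_nth (S x ^ m) i = fps_nth (S y ^ m) i" if "i \<le> n - k" for m i
    using that
  proof (induction m arbitrary: i)
    case (Suc m)
    have "fps_nth (S x) j = fps_nth (S y) j" if "j \<le> i" for j
      using that Suc.prems assms by (simp add: S_def)
    with Suc show ?case
      by (auto simp: fps_mult_nth intro!: sum.cong)
  qed simp
  show ?thesis
    unfolding partial_Bell_def * by (simp add: power_mult_distrib fps_X_power_mult_nth pw)
qed

lemma has_fps_expansion_unique_real: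
  fixes f :: "real \<Rightarrow> real"
  assumes "f has_fps_expansion F" "f has_fps_expansion G"
  shows "F = G"
proof (rule ccontr)
  assume "F \<noteq> G"
  define H where "H = F - G"
  define m where "m = subdegree H"
  define c where "c = fps_nth H m"
  have "c \<noteq> 0" using \<open>F \<noteq> G\<close> nth_subdegree_nonzero[of H]
    unfolding c_def m_def by (simp add: H_def del: fps_sub_nth)
  have "(\<lambda>x. f x - f x) has_fps_expansion H"
    unfolding H_def by (intro has_fps_expansion_diff assms)
  then have "(\<lambda>x. if x = 0 then c else (f x - f x) / x ^ m) has_fps_expansion fps_shift m H"
    by (rule has_fps_expansion_shift) (simp_all add: c_def m_def)
  then have "isCont (\<lambda>x. if x = 0 then c else (f x - f x) / x ^ m) 0"
    by (rule has_fps_expansion_imp_continuous)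
  then have "((\<lambda>x::real. if x = 0 then c else 0) \<longlongrightarrow> c) (at 0)"
    by (simp add: isCont_def if_distrib cong: if_cong)
  moreover have "((\<lambda>x::real. if x = 0 then c else 0) \<longlongrightarrow> 0) (at 0)"
    by (rule tendsto_eventually) (simp add: eventually_at_filter)
  ultimately have "c = 0" by (rule tendsto_unique[rotated]) simp
  with \<open>c \<noteq> 0\<close> show False ..
qed

lemma prob_Lah_eqI:
  assumes "(\<lambda>t::real. 1 / fact k *
       ((LINT \<omega>|M. (1 / (1 - t)) powr Y \<omega>) - 1) ^ k) has_fps_expansion F"
  shows "prob_Lah M Y n k = fact n * fps_nth F n"
proof -
  have "(THE F. (\<lambda>t::real. 1 / fact k *
       ((LINT \<omega>|M. (1 / (1 - t)) powr Y \<omega>) - 1) ^ k) has_fps_expansion F) = F"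
  proof (rule the_equality)
    fix G
    assume "(\<lambda>t::real. 1 / fact k *
       ((LINT \<omega>|M. (1 / (1 - t)) powr Y \<omega>) - 1) ^ k) has_fps_expansion G"
    with assms show "G = F"
      by (rule has_fps_expansion_unique_real[rotated])
  qed fact
  then show ?thesis by (simp add: prob_Lah_def)
qed

end

theory Submission
  imports Defs
begin

text \<open>
  Let \<open>G\<close> be the power series of \<open>E[(1/(1-t))\<^sup>Y] - 1\<close> at \<open>0\<close>. The exponential generating function
  of the Lah-Bell polynomials is \<open>exp (x G)\<close>, so the sequence \<open>i B\<^sub>i\<^sub>-\<^sub>1(x)\<close> has exponential generating
  function \<open>t exp (x G)\<close>, whose \<open>k\<close>-th power is \<open>t\<^sup>k exp (k x G)\<close>; comparing coefficients gives the
  identity. That \<open>G\<close> exists follows by integrating the binomial series of \<open>(1/(1-t))\<^sup>Y\<close> termwise: its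
  partial sums are dominated by \<open>exp (s Y) + exp (- s Y)\<close> for some \<open>0 < s < r\<close>.
\<close>

text \<open>Binomial series with exponent \<open>- a\<close> at \<open>- t\<close>: the sign
  \<open>(- 1) ^ n\<close> in \<open>(- a) gchoose n\<close> cancels the one in
  \<open>(- t) ^ n\<close>.\<close>

lemma pochhammer_series_sums:
  fixes a t :: real
  assumes "\<bar>t\<bar> < 1"
  shows "(\<lambda>n. pochhammer a n / fact n * t ^ n) sums ((1 / (1 - t)) powr a)"
proof -
  have "(\<lambda>n. ((- a) gchoose n) * (- t) ^ n) sums (1 + - t) powr (- a)"
    by (rule gen_binomial_real) (use assms in simp)
  moreover have "((- a) gchoose n) * (- t) ^ n = pochhammer a n / fact n * t ^ n" for n
    by (simp add: gbinomial_pochhammer power_minus[of t] field_simps)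
  moreover have "(1 + - t) powr (- a) = (1 / (1 - t)) powr a"
    using assms by (simp add: powr_minus powr_divide inverse_eq_divide)
  ultimately show ?thesis by simp
qed

lemma abs_pochhammer_le: "\<bar>pochhammer a n\<bar> \<le> pochhammer \<bar>a\<bar> n" for a :: real
  unfolding pochhammer_prod abs_prod
  by (intro prod_mono) (auto intro: order_trans[OF abs_triangle_ineq])

text \<open>Passing to \<open>\<bar>a\<bar>\<close> and \<open>u\<close> makes all terms
  nonnegative, so the partial sum stays below the full series, a power of
  \<open>1 / (1 - u)\<close>. The bound is independent of \<open>N\<close> and \<open>t\<close>, and
  at \<open>a = Y \<omega>\<close> it is a sum of two integrable exponentials.\<close>

lemma pochhammer_partial_sum_le:
  fixes a t u :: real
  assumes "\<bar>t\<bar> \<le> u" "u < 1"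
  shows "(\<Sum>n<N. \<bar>pochhammer a n / fact n * t ^ n\<bar>) \<le>
           exp (- ln (1 - u) * a) + exp (ln (1 - u) * a)"
proof -
  have nn: "pochhammer \<bar>a\<bar> n \<ge> 0" for n
    using abs_pochhammer_le[of a n] abs_ge_zero order_trans by blast
  have "(\<Sum>n<N. \<bar>pochhammer a n / fact n * t ^ n\<bar>) \<le>
          (\<Sum>n<N. pochhammer \<bar>a\<bar> n / fact n * u ^ n)"
    unfolding abs_mult abs_divide power_abs
    by (intro sum_mono mult_mono divide_mono power_mono abs_pochhammer_le)
       (use assms in \<open>auto intro!: divide_nonneg_nonneg nn\<close>)
  also have "\<dots> \<le> (1 / (1 - u)) powr \<bar>a\<bar>"
  proof -
    have u: "(\<lambda>n. pochhammer \<bar>a\<bar> n / fact n * u ^ n) sums ((1 / (1 - u)) powr \<bar>a\<bar>)"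
      by (rule pochhammer_series_sums) (use assms in auto)
    show ?thesis
      unfolding sums_unique[OF u] using assms
      by (intro sum_le_suminf sums_summable[OF u]) (auto intro!: mult_nonneg_nonneg divide_nonneg_nonneg nn)
  qed
  also have "\<dots> = exp (- ln (1 - u) * \<bar>a\<bar>)"
    using assms by (simp add: powr_def ln_div)
  \<comment> \<open>One summand equals the left side, according to the sign of \<open>a\<close>; the
    other is positive.\<close>
  also have "\<dots> \<le> exp (- ln (1 - u) * a) + exp (ln (1 - u) * a)"
    by (cases "a \<ge> 0") (simp_all)
  finally show ?thesis .
qed

text \<open>Convergence at the single point \<open>u\<close> already forces the radius of
  convergence to be at least \<open>u\<close>.\<close>

lemma has_fps_expansion_realI:
  fixes f :: "real \<Rightarrow> real"
  assumes "u > 0" and sums: "\<And>t. \<bar>t\<bar> \<le> u \<Longrightarrow> (\<lambda>n. c n * t ^ n) sums f t"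
  shows "f has_fps_expansion Abs_fps c"
  unfolding has_fps_expansion_def
proof
  have "ereal (norm u) \<le> conv_radius c"
    by (rule conv_radius_geI) (use sums_summable[OF sums[of u]] assms(1) in simp)
  then show "fps_conv_radius (Abs_fps c) > 0"
    using assms(1) by (simp add: fps_conv_radius_def less_le_trans[rotated])
  have "eventually (\<lambda>t. t \<in> {- u <..< u}) (nhds 0)"
    by (rule eventually_nhds_in_open) (use assms(1) in auto)
  then show "eventually (\<lambda>t. eval_fps (Abs_fps c) t = f t) (nhds 0)"
  proof eventually_elim
    case (elim t)
    then show ?case using sums_unique[OF sums[of t]] by (auto simp: eval_fps_def)
  qed
qed

lemma (in prob_space) expectation_powr_has_fps_expansion:
  fixes Y :: "'a \<Rightarrow> real"
  assumes [measurable]: "Y \<in> borel_measurable M"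
    and "r > 0"
    and mgf: "\<And>t::real. \<bar>t\<bar> < r \<Longrightarrow> integrable M (\<lambda>\<omega>. exp (t * Y \<omega>))"
  shows "(\<lambda>t. expectation (\<lambda>\<omega>. (1 / (1 - t)) powr Y \<omega>)) has_fps_expansion
           Abs_fps (\<lambda>n. expectation (\<lambda>\<omega>. pochhammer (Y \<omega>) n / fact n))"
proof -
  \<comment> \<open>Chosen so that \<open>W\<close> involves the moment generating function only at
    \<open>r / 2\<close> and \<open>- r / 2\<close>, inside its domain.\<close>
  define u where "u = 1 - exp (- r / 2)"
  have u: "0 < u" "u < 1" "ln (1 - u) = - r / 2"
    using \<open>r > 0\<close> by (auto simp: u_def)
  define W where "W = (\<lambda>\<omega>. exp (- ln (1 - u) * Y \<omega>) + exp (ln (1 - u) * Y \<omega>))"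
  define p where "p = (\<lambda>t n \<omega>. pochhammer (Y \<omega>) n / fact n * t ^ n)"
  have W: "integrable M W"
    unfolding W_def using \<open>r > 0\<close> by (intro Bochner_Integration.integrable_add mgf) (auto simp: u)
  have [measurable]: "p t n \<in> borel_measurable M" for t n
    unfolding p_def pochhammer_prod by measurable
  have bound: "(\<Sum>n<N. \<bar>p t n \<omega>\<bar>) \<le> W \<omega>" if "\<bar>t\<bar> \<le> u" for t N \<omega>
    unfolding p_def W_def by (rule pochhammer_partial_sum_le) (use that u in auto)
  have int: "integrable M (p t n)" if "\<bar>t\<bar> \<le> u" for t n
  proof (rule Bochner_Integration.integrable_bound[OF W])
    \<comment> \<open>A single term is at most the sum of absolute values up to index
      \<open>n\<close>.\<close>
    have "\<bar>p t n \<omega>\<bar> \<le> W \<omega>" for \<omega>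
      by (rule order_trans[OF member_le_sum bound[OF that, of \<omega> "Suc n"]]) auto
    then show "AE \<omega> in M. norm (p t n \<omega>) \<le> norm (W \<omega>)"
      by (auto intro!: AE_I2 order_trans[OF _ abs_ge_self])
  qed measurable
  show ?thesis
  proof (rule has_fps_expansion_realI[OF u(1)])
    fix t :: real
    assume t: "\<bar>t\<bar> \<le> u"
    have "(\<lambda>N. expectation (\<lambda>\<omega>. \<Sum>n<N. p t n \<omega>)) \<longlonglongrightarrow>
            expectation (\<lambda>\<omega>. (1 / (1 - t)) powr Y \<omega>)"
    proof (rule integral_dominated_convergence[OF _ _ W])
      show "AE \<omega> in M. (\<lambda>N. \<Sum>n<N. p t n \<omega>) \<longlonglongrightarrow> (1 / (1 - t)) powr Y \<omega>"
        using pochhammer_series_sums[of t] t u by (auto simp: p_def sums_def)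
      show "AE \<omega> in M. norm (\<Sum>n<N. p t n \<omega>) \<le> W \<omega>" for N
        using bound[OF t] by (auto intro!: AE_I2 order_trans[OF sum_abs])
    qed measurable
    moreover have "expectation (\<lambda>\<omega>. \<Sum>n<N. p t n \<omega>) =
        (\<Sum>n<N. expectation (\<lambda>\<omega>. pochhammer (Y \<omega>) n / fact n) * t ^ n)" for N
      using int[OF t] by (subst Bochner_Integration.integral_sum) (auto simp: p_def)
    ultimately show "(\<lambda>n. expectation (\<lambda>\<omega>. pochhammer (Y \<omega>) n / fact n) * t ^ n) sums
        expectation (\<lambda>\<omega>. (1 / (1 - t)) powr Y \<omega>)"
      by (simp add: sums_def)
  qed
qed

lemma fps_exp_compose_power:
  fixes G :: "real fps"
  assumes "fps_nth G 0 = 0"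
  shows "(fps_exp x oo G) ^ k = fps_exp (real k * x) oo G"
  by (simp add: fps_compose_power[OF assms] fps_exp_power_mult)

theorem theorem2p9:
  fixes M :: "'a measure" and Y :: "'a \<Rightarrow> real" and r x :: real and n k :: nat
  assumes "prob_space M"
    and "Y \<in> borel_measurable M"
    and "r > 0"
    and "\<And>t::real. \<bar>t\<bar> < r \<Longrightarrow> integrable M (\<lambda>\<omega>. exp (t * Y \<omega>))"
    and "k \<le> n"
  shows "(\<Sum>j=0..n - k. real (n choose k) * real k ^ j * x ^ j * prob_Lah M Y (n - k) j) =
    partial_Bell n k (\<lambda>i. real i * prob_Lah_Bell M Y (i - 1) x)"
proof -
  interpret prob_space M by fact
  \<comment> \<open>Subtracting 1 removes the constant term, since \<open>M\<close> has total mass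
    1; this makes composition with \<open>G\<close> compatible with powers.\<close>
  define G where "G = Abs_fps (\<lambda>n. expectation (\<lambda>\<omega>. pochhammer (Y \<omega>) n / fact n)) - 1"
  have G0: "fps_nth G 0 = 0"
    by (simp add: G_def prob_space)
  have "(\<lambda>t. expectation (\<lambda>\<omega>. (1 / (1 - t)) powr Y \<omega>) - 1) has_fps_expansion G"
    unfolding G_def
    by (intro has_fps_expansion_diff has_fps_expansion_1
          expectation_powr_has_fps_expansion[OF assms(2-4)])
  then have "(\<lambda>t. (expectation (\<lambda>\<omega>. (1 / (1 - t)) powr Y \<omega>) - 1) ^ j)
      has_fps_expansion G ^ j" for j
    by (induction j) (auto intro: has_fps_expansion_mult)
  then have "(\<lambda>t. 1 / fact j * (expectation (\<lambda>\<omega>. (1 / (1 - t)) powr Y \<omega>) - 1) ^ j)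
      has_fps_expansion fps_const (1 / fact j) * G ^ j" for j
    by (intro has_fps_expansion_mult has_fps_expansion_const)
  then have Lah: "prob_Lah M Y m j = fact m * (fps_nth (G ^ j) m / fact j)" for m j
    by (subst prob_Lah_eqI) auto
  \<comment> \<open>Stated for arbitrary \<open>y\<close> because it serves twice:
    \<open>y = x\<close> for the Lah-Bell polynomials, \<open>y = k * x\<close> for the final
    sum.\<close>
  have egf: "(\<Sum>j=0..m. y ^ j * prob_Lah M Y m j) = fact m * fps_nth (fps_exp y oo G) m" for y m
    by (simp add: Lah fps_compose_nth sum_distrib_left mult_ac)
  have Bell: "prob_Lah_Bell M Y m x = fact m * fps_nth (fps_exp x oo G) m" for m
    using egf[of x m] by (simp add: prob_Lah_Bell_def mult.commute)
  \<comment> \<open>The factor \<open>j\<close> turns \<open>fact j\<close> into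
    \<open>fact (j - 1)\<close>, which is a shift by \<open>fps_X\<close>.\<close>
  have "Abs_fps (\<lambda>j. if j = 0 then 0 else real j * prob_Lah_Bell M Y (j - 1) x / fact j) =
      fps_X * (fps_exp x oo G)"
  proof (rule fps_ext)
    show "fps_nth (Abs_fps (\<lambda>j. if j = 0 then 0 else
        real j * prob_Lah_Bell M Y (j - 1) x / fact j)) i = fps_nth (fps_X * (fps_exp x oo G)) i" for i
      by (cases i) (simp_all add: Bell del: of_nat_Suc)
  qed
  \<comment> \<open>The \<open>k\<close>-th power contributes \<open>fps_X ^ k\<close>, which moves
    the coefficient index from \<open>n\<close> to \<open>n - k\<close>.\<close>
  then have "partial_Bell n k (\<lambda>i. real i * prob_Lah_Bell M Y (i - 1) x) =
      fact n / fact k * fps_nth (fps_exp (real k * x) oo G) (n - k)"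
    using \<open>k \<le> n\<close>
    by (simp add: partial_Bell_def power_mult_distrib fps_X_power_mult_nth
          fps_exp_compose_power[OF G0] del: One_nat_def)
  also have "\<dots> = real (n choose k) * (fact (n - k) * fps_nth (fps_exp (real k * x) oo G) (n - k))"
    using \<open>k \<le> n\<close> by (simp add: binomial_fact)
  also have "\<dots> = (\<Sum>j=0..n - k. real (n choose k) * real k ^ j * x ^ j * prob_Lah M Y (n - k) j)"
    by (simp add: egf[symmetric] power_mult_distrib sum_distrib_left mult.assoc)
  finally show ?thesis ..
qed

end
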